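(* Let $\mathcal{H}$ be an infinite dimensional complex Hilbert space, let $A,B\in B(\mathcal{H})$ be Drazin invertible with Drazin inverses $A_d,B_d$, let $X,Y\in B(\mathcal{H})$ and let $m,n\ge1$ be integers. If $(A_d^*,A)$ is left-$(X,m)$-invertible, $(B_d^*,B)$ is left-$(Y,n)$-invertible, $$[X,Y]=[A,B]=[A^*,Y]=[B^*,X]=0,$$ and $AB=0$, then $$\triangle_{(A+B)_d^*,\,A+B}^{m+n-1}(XY)=0.$$
   Context: $B(\mathcal{H})$ is the algebra of bounded linear operators on $\mathcal{H}$, and $[S,T]=ST-TS$. For $S,T,Z\in B(\mathcal{H})$ and an integer $m\ge 1$ put $$\triangle_{S,T}^m(Z)=\sum_{j=0}^m(-1)^j\binom{m}{j}S^{m-j}ZT^{m-j}.$$ $(S,T)$ is left-$(Z,m)$-invertible if $\triangle_{S,T}^m(Z)=0$. $A$ is Drazin invertible, with Drazin inverse $A_d\in B(\mathcal{H})$, if $A_dA=AA_d$, $A_d^2A=A_d$ and $A^{p+1}A_d=A^p$ for some integer $p\ge1$. $A_d^*$ denotes $(A_d)^*$. It is a known fact that if $A,B$ are commuting Drazin invertible operators with $AB=0$ then $A+B$ is Drazin invertible; $(A+B)_d$ is its Drazin inverse and $(A+B)_d^*=((A+B)_d)^*=(A^*+B^* )_d$. *)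

theory Defs
  imports "HOL-Analysis.Analysis"
begin

text \<open>Complex Hilbert spaces. The real vector space operations of a complex space are the
  restriction of the complex ones, so that the real normed space library applies to it.\<close>

class complex_vector = real_vector +
  fixes scaleC :: "complex \<Rightarrow> 'a \<Rightarrow> 'a" (infixr "*\<^sub>C" 75)
  assumes scaleR_scaleC: "r *\<^sub>R x = complex_of_real r *\<^sub>C x"
    and scaleC_add_right: "c *\<^sub>C (x + y) = c *\<^sub>C x + c *\<^sub>C y"
    and scaleC_add_left: "(c + d) *\<^sub>C x = c *\<^sub>C x + d *\<^sub>C x"
    and scaleC_scaleC: "c *\<^sub>C (d *\<^sub>C x) = (c * d) *\<^sub>C x"
    and scaleC_one: "1 *\<^sub>C x = x"

global_interpretation cvec: vector_space "scaleC :: complex \<Rightarrow> 'a \<Rightarrow> 'a::complex_vector"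
  by unfold_locales
    (simp_all add: scaleC_add_right scaleC_add_left scaleC_scaleC scaleC_one)

text \<open>The inner product is linear in the first argument; \<open>cinner_norm\<close> contains its positive
  definiteness, since \<open>norm\<close> is a norm already.\<close>

class complex_inner = complex_vector + real_normed_vector +
  fixes cinner :: "'a \<Rightarrow> 'a \<Rightarrow> complex"
  assumes cinner_commute: "cinner x y = cnj (cinner y x)"
    and cinner_add_left: "cinner (x + y) z = cinner x z + cinner y z"
    and cinner_scaleC_left: "cinner (c *\<^sub>C x) y = c * cinner x y"
    and cinner_norm: "cinner x x = complex_of_real ((norm x)\<^sup>2)"

class chilbert_space = complex_inner + complete_space

subclass (in chilbert_space) banach ..

lemma cinner_add_right: "cinner x (y + z) = cinner x y + cinner (x::'a::complex_inner) z"
  by (metis cinner_commute cinner_add_left complex_cnj_add)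

lemma cinner_scaleC_right: "cinner x (c *\<^sub>C y) = cnj c * cinner (x::'a::complex_inner) y"
  by (metis cinner_commute cinner_scaleC_left complex_cnj_mult)

lemma cinner_minus_left: "cinner (- x) y = - cinner (x::'a::complex_inner) y"
  using cinner_scaleC_left[of "-1" x y] by (simp add: cvec.scale_minus_left scaleC_one)

lemma cinner_minus_right: "cinner x (- y) = - cinner (x::'a::complex_inner) y"
  using cinner_scaleC_right[of x "-1" y] by (simp add: cvec.scale_minus_left scaleC_one)

lemma cinner_diff_left: "cinner (x - y) z = cinner x z - cinner (y::'a::complex_inner) z"
  using cinner_add_left[of x "- y" z] by (simp add: cinner_minus_left)

lemma cinner_diff_right: "cinner x (y - z) = cinner x y - cinner (x::'a::complex_inner) z"
  using cinner_add_right[of x y "- z"] by (simp add: cinner_minus_right)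

lemma cinner_zero [simp]: "cinner 0 y = 0" "cinner (y::'a::complex_inner) 0 = 0"
  using cinner_diff_left[of 0 0 y] cinner_diff_right[of y 0 0] by simp_all

lemma cinner_eq_zero_iff: "cinner x x = 0 \<longleftrightarrow> (x::'a::complex_inner) = 0"
  by (simp add: cinner_norm)

lemma cinner_extI: 
  assumes "\<And>x. cinner x y = cinner x z" shows "(y::'a::complex_inner) = z"
proof -
  have "cinner (y - z) (y - z) = 0" 
    unfolding cinner_diff_right using assms by simp
  then show ?thesis by (simp add: cinner_eq_zero_iff)
qed

lemma norm_scaleC: "norm (c *\<^sub>C x) = cmod c * norm (x::'a::complex_inner)"
proof -
  have "complex_of_real ((norm (c *\<^sub>C x))\<^sup>2) = c * (cnj c * cinner x x)"
    by (subst cinner_norm[symmetric]) (simp only: cinner_scaleC_left cinner_scaleC_right mult.left_commute)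
  also have "\<dots> = complex_of_real ((cmod c * norm x)\<^sup>2)"
    by (simp only: cinner_norm power_mult_distrib of_real_mult complex_norm_square mult.assoc)
  finally have "(norm (c *\<^sub>C x))\<^sup>2 = (cmod c * norm x)\<^sup>2"
    by (simp only: of_real_eq_iff)
  then show ?thesis by (simp add: power2_eq_iff_nonneg)
qed

lemma norm_add_square:
  "(norm (x + y))\<^sup>2 = (norm x)\<^sup>2 + 2 * Re (cinner x y) + (norm (y::'a::complex_inner))\<^sup>2"
proof -
  have "(norm (x + y))\<^sup>2 = Re (cinner (x + y) (x + y))" 
    unfolding cinner_norm by (rule Re_complex_of_real[symmetric])
  also have "\<dots> = Re (cinner x x) + Re (cinner x y) + Re (cinner y x) + Re (cinner y y)"
    by (simp add: cinner_add_left cinner_add_right)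
  also have "Re (cinner y x) = Re (cinner x y)"
    by (subst cinner_commute) simp
  finally show ?thesis by (simp add: cinner_norm)
qed

lemma complex_parallelogram:
  "(norm (x + y))\<^sup>2 + (norm (x - y))\<^sup>2 = 2 * (norm x)\<^sup>2 + 2 * (norm (y::'a::complex_inner))\<^sup>2"
  using norm_add_square[of x y] norm_add_square[of x "- y"] by (simp add: cinner_minus_right)

lemma complex_Cauchy_Schwarz: "cmod (cinner x y) \<le> norm x * norm (y::'a::complex_inner)"
proof -
  have *: "Re (cinner z y) \<le> norm z * norm y" for z
  proof -
    have "(norm (z + y))\<^sup>2 \<le> (norm z + norm y)\<^sup>2" 
      by (intro power_mono norm_triangle_ineq) simp
    then show ?thesis unfolding norm_add_square by (simp add: power2_sum)
  qed
  show ?thesis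
  proof (cases "cinner x y = 0")
    case False
    define c where "c = cnj (cinner x y) / cmod (cinner x y)"
    have c: "cmod c = 1" using False by (simp add: c_def norm_divide)
    have "cinner (c *\<^sub>C x) y = cinner x y * cnj (cinner x y) / cmod (cinner x y)"
      by (simp add: cinner_scaleC_left c_def)
    also have "\<dots> = cmod (cinner x y)"
      using False by (simp only: complex_norm_square[symmetric]) (simp add: power2_eq_square)
    finally have "cinner (c *\<^sub>C x) y = cmod (cinner x y)" .
    with *[of "c *\<^sub>C x"] show ?thesis by (simp add: norm_scaleC c)
  qed simp
qed

text \<open>The algebra \<open>B(H)\<close>, with composition as multiplication. \<open>bounded_linear\<close> is real linearity
  and boundedness; homogeneity over the complex numbers is the extra condition. There is no
  \<open>ring_1\<close> instance, because \<open>0 = 1\<close> in the operator algebra of the zero space.\<close>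

typedef (overloaded) 'a bop =
  "{f :: 'a::complex_inner \<Rightarrow> 'a. bounded_linear f \<and> (\<forall>c x. f (c *\<^sub>C x) = c *\<^sub>C f x)}"
  morphisms bop_apply Abs_bop
  by (rule exI[of _ "\<lambda>x. x"]) (auto intro: bounded_linear_ident)

setup_lifting type_definition_bop

lemma bop_eqI: "(\<And>x. bop_apply S x = bop_apply T x) \<Longrightarrow> S = T"
  by transfer auto

lemma bop_bounded_linear: "bounded_linear (bop_apply T)"
  by transfer auto

lemma bop_scaleC: "bop_apply T (c *\<^sub>C x) = c *\<^sub>C bop_apply T x"
  by transfer auto

instantiation bop :: (complex_inner) "{real_algebra, monoid_mult}"
begin

lift_definition zero_bop :: "'a bop" is "\<lambda>x. 0" by simp
lift_definition one_bop :: "'a bop" is "\<lambda>x. x" by simp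
lift_definition plus_bop :: "'a bop \<Rightarrow> 'a bop \<Rightarrow> 'a bop" is "\<lambda>S T x. S x + T x"
  by (auto intro: bounded_linear_add simp: scaleC_add_right)
lift_definition minus_bop :: "'a bop \<Rightarrow> 'a bop \<Rightarrow> 'a bop" is "\<lambda>S T x. S x - T x"
  by (auto intro: bounded_linear_sub simp: cvec.scale_right_diff_distrib)
lift_definition uminus_bop :: "'a bop \<Rightarrow> 'a bop" is "\<lambda>T x. - T x"
  by (auto intro: bounded_linear_minus)
lift_definition times_bop :: "'a bop \<Rightarrow> 'a bop \<Rightarrow> 'a bop" is "\<lambda>S T x. S (T x)"
  by (auto intro: bounded_linear_compose)
lift_definition scaleR_bop :: "real \<Rightarrow> 'a bop \<Rightarrow> 'a bop" is "\<lambda>r T x. r *\<^sub>R T x"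
  by (auto intro: bounded_linear_const_scaleR)
    (simp add: scaleR_scaleC mult.commute)

instance
  by standard
    (transfer, auto simp: algebra_simps fun_eq_iff linear_add linear_scale
       dest: bounded_linear.linear)+

end

text \<open>Adjoints. The description picks out a unique operator, by Riesz representation.\<close>

definition adj :: "'a::chilbert_space bop \<Rightarrow> 'a bop" where
  "adj T = (THE S. \<forall>x y. cinner (bop_apply T x) y = cinner x (bop_apply S y))"

lemma Riesz_representation:
  fixes f :: "'a::chilbert_space \<Rightarrow> complex"
  assumes bl: "bounded_linear f" and sc: "\<And>c x. f (c *\<^sub>C x) = c * f x"
  shows "\<exists>z. \<forall>x. f x = cinner x z"
proof (cases "\<forall>x. f x = 0")
  case True
  then show ?thesis by (intro exI[of _ 0]) simp
next
  case False
  interpret f: bounded_linear f by (rule bl)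
  from False obtain u where u: "f u \<noteq> 0" by blast
  define C where "C = {x. f x = 1}"
  define d where "d = (INF x\<in>C. (norm x)\<^sup>2)"
  have "inverse (f u) *\<^sub>C u \<in> C" using u by (simp add: C_def sc)
  then have ne: "C \<noteq> {}" by blast
  have bdd: "bdd_below ((\<lambda>x. (norm x)\<^sup>2) ` C)"
    by (rule bdd_belowI2[of _ 0]) simp
  have dle: "d \<le> (norm x)\<^sup>2" if "x \<in> C" for x
    unfolding d_def by (rule cINF_lower[OF bdd that])
  have "\<exists>x\<in>C. (norm x)\<^sup>2 < d + 1 / real (Suc n)" for n
  proof -
    have "d < d + 1 / real (Suc n)" by simp
    then show ?thesis
      using cINF_less_iff[OF ne bdd, of "d + 1 / real (Suc n)"] unfolding d_def by blast
  qed
  then obtain s where sC: "\<And>n. s n \<in> C" and sd: "\<And>n. (norm (s n))\<^sup>2 < d + 1 / real (Suc n)"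
    by metis
  have dist: "(norm (s m - s n))\<^sup>2 \<le> 2 / real (Suc m) + 2 / real (Suc n)" for m n
  proof -
    have "(1/2) *\<^sub>R (s m + s n) \<in> C"
      using sC[of m] sC[of n] by (simp add: C_def f.scaleR f.add scaleR_conv_of_real)
    then have "4 * d \<le> (norm (s m + s n))\<^sup>2"
      using dle by (fastforce simp: power_mult_distrib power_divide)
    with complex_parallelogram[of "s m" "s n"] sd[of m] sd[of n] show ?thesis by simp
  qed
  have "Cauchy s"
  proof (rule metric_CauchyI)
    fix e :: real assume e: "0 < e"
    obtain N where N: "inverse (real (Suc N)) < e\<^sup>2 / 4"
      using reals_Archimedean[of "e\<^sup>2/4"] e by auto
    show "\<exists>M. \<forall>m\<ge>M. \<forall>n\<ge>M. dist (s m) (s n) < e"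
    proof (intro exI allI impI)
      fix m n assume "N \<le> m" "N \<le> n"
      have le: "2 / real (Suc k) \<le> 2 * inverse (real (Suc N))" if "N \<le> k" for k
        using that by (simp add: field_simps)
      have "(norm (s m - s n))\<^sup>2 \<le> 2 * inverse (real (Suc N)) + 2 * inverse (real (Suc N))"
        using dist[of m n] le[OF \<open>N \<le> m\<close>] le[OF \<open>N \<le> n\<close>] by (rule order_trans[OF _ add_mono])
      also have "\<dots> < e\<^sup>2" using N by (simp del: of_nat_Suc)
      finally have "(norm (s m - s n))\<^sup>2 < e\<^sup>2" .
      then show "dist (s m) (s n) < e"
        using e by (simp add: dist_norm power_less_imp_less_base)
    qed
  qed
  then obtain v where v: "s \<longlonglongrightarrow> v" 
    using Cauchy_convergent convergent_def by blast
  have "(\<lambda>n. f (s n)) \<longlonglongrightarrow> f v" by (rule f.tendsto[OF v])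
  then have fv: "f v = 1" using sC by (simp add: C_def LIMSEQ_const_iff)
  have vd: "(norm v)\<^sup>2 \<le> d"
  proof (rule LIMSEQ_le)
    show "(\<lambda>n. (norm (s n))\<^sup>2) \<longlonglongrightarrow> (norm v)\<^sup>2" by (intro tendsto_intros v)
    show "(\<lambda>n. d + 1 / real (Suc n)) \<longlonglongrightarrow> d"
      using tendsto_add[OF tendsto_const LIMSEQ_inverse_real_of_nat, of d] 
      by (simp add: divide_inverse)
    show "\<exists>N. \<forall>n\<ge>N. (norm (s n))\<^sup>2 \<le> d + 1 / real (Suc n)" 
      using sd less_imp_le by blast
  qed
  have orth: "cinner w v = 0" if w: "f w = 0" for w
  proof (cases "w = 0")
    case False
    define c where "c = - (cinner v w / complex_of_real ((norm w)\<^sup>2))"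
    have "v + c *\<^sub>C w \<in> C" by (simp add: C_def f.add sc w fv)
    then have "(norm v)\<^sup>2 \<le> (norm (v + c *\<^sub>C w))\<^sup>2" by (rule order_trans[OF vd dle])
    also have "\<dots> = (norm v)\<^sup>2 - (cmod (cinner v w))\<^sup>2 / (norm w)\<^sup>2"
    proof -
      have "Re (cnj c * cinner v w) = - ((cmod (cinner v w))\<^sup>2 / (norm w)\<^sup>2)"
      proof -
        have "cnj c * cinner v w = - complex_of_real ((cmod (cinner v w))\<^sup>2 / (norm w)\<^sup>2)"
          unfolding c_def of_real_divide complex_norm_square[of "cinner v w"] by simp
        then show ?thesis by (metis Re_complex_of_real uminus_complex.sel(1))
      qed
      moreover have "(norm (c *\<^sub>C w))\<^sup>2 = (cmod (cinner v w))\<^sup>2 / (norm w)\<^sup>2"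
      proof -
        have "cmod c = cmod (cinner v w) / (norm w)\<^sup>2"
          by (simp add: c_def norm_divide norm_power)
        then have "norm (c *\<^sub>C w) = cmod (cinner v w) / norm w"
          using False by (simp add: norm_scaleC power2_eq_square)
        then show ?thesis by (simp add: power_divide)
      qed
      ultimately show ?thesis by (simp add: norm_add_square cinner_scaleC_right)
    qed
    finally have "(cmod (cinner v w))\<^sup>2 / (norm w)\<^sup>2 \<le> 0" by simp
    then have "cinner v w = 0" using False by (simp add: divide_le_0_iff)
    then show ?thesis by (subst cinner_commute) simp
  qed simp
  have v0: "v \<noteq> 0" using fv f.zero by auto
  define z where "z = complex_of_real (inverse ((norm v)\<^sup>2)) *\<^sub>C v"
  have "f x = cinner x z" for x
  proof -
    have "f (x - f x *\<^sub>C v) = 0" by (simp add: f.diff sc fv)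
    from orth[OF this] have "cinner x v = f x * complex_of_real ((norm v)\<^sup>2)"
      by (simp add: cinner_diff_left cinner_scaleC_left cinner_norm)
    then show ?thesis using v0 by (simp add: z_def cinner_scaleC_right)
  qed
  then show ?thesis by blast
qed

lemma adj_ex1:
  fixes T :: "'a::chilbert_space bop"
  shows "\<exists>!S. \<forall>x y. cinner (bop_apply T x) y = cinner x (bop_apply S y)"
proof (rule ex_ex1I)
  interpret T: bounded_linear "bop_apply T" by (rule bop_bounded_linear)
  have "\<exists>z. \<forall>x. cinner (bop_apply T x) y = cinner x z" for y
  proof (rule Riesz_representation)
    obtain K where K: "\<And>x. norm (bop_apply T x) \<le> norm x * K" using T.bounded by blast
    show "bounded_linear (\<lambda>x. cinner (bop_apply T x) y)"
    proof (rule bounded_linear_intro)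
      fix x show "cmod (cinner (bop_apply T x) y) \<le> norm x * (K * norm y)"
        using order_trans[OF complex_Cauchy_Schwarz mult_right_mono[OF K norm_ge_zero]]
        by (simp add: mult.assoc)
    qed (simp_all add: T.add T.scaleR cinner_add_left scaleR_scaleC bop_scaleC cinner_scaleC_left
          scaleR_conv_of_real)
  qed (simp add: bop_scaleC cinner_scaleC_left)
  then obtain g where g: "\<And>x y. cinner (bop_apply T x) y = cinner x (g y)" by metis
  have scg: "g (c *\<^sub>C y) = c *\<^sub>C g y" for c y
    by (rule cinner_extI) (simp add: g[symmetric] cinner_scaleC_right)
  obtain K where K: "\<And>x. norm (bop_apply T x) \<le> norm x * K" "0 < K"
    using T.pos_bounded by blast
  have "bounded_linear g"
  proof (rule bounded_linear_intro)
    fix x y show "g (x + y) = g x + g y"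
      by (rule cinner_extI) (simp add: g[symmetric] cinner_add_right)
  next
    fix r x show "g (r *\<^sub>R x) = r *\<^sub>R g x" by (simp add: scaleR_scaleC scg)
  next
    fix y
    have "(norm (g y))\<^sup>2 = cmod (cinner (g y) (g y))" by (simp add: cinner_norm norm_power)
    also have "\<dots> = cmod (cinner (bop_apply T (g y)) y)" by (simp add: g)
    also have "\<dots> \<le> norm (g y) * K * norm y"
      by (rule order_trans[OF complex_Cauchy_Schwarz mult_right_mono[OF K(1) norm_ge_zero]])
    finally have "norm (g y) * norm (g y) \<le> norm (g y) * (norm y * K)"
      by (simp add: power2_eq_square mult_ac)
    then show "norm (g y) \<le> norm y * K"
      using K(2) by (cases "norm (g y) = 0") (auto simp: mult_le_cancel_left)
  qed
  then have "bop_apply (Abs_bop g) = g" by (intro Abs_bop_inverse) (simp add: scg)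
  with g show "\<exists>S. \<forall>x y. cinner (bop_apply T x) y = cinner x (bop_apply S y)"
    by (intro exI[of _ "Abs_bop g"]) simp
next
  fix S S' :: "'a bop"
  assume "\<forall>x y. cinner (bop_apply T x) y = cinner x (bop_apply S y)"
    "\<forall>x y. cinner (bop_apply T x) y = cinner x (bop_apply S' y)"
  then show "S = S'" by (intro bop_eqI cinner_extI) metis
qed

lemma cinner_adj: "cinner (bop_apply T x) y = cinner x (bop_apply (adj T) y)"
  using theI'[OF adj_ex1[of T]] unfolding adj_def by blast

definition drazin_inverse :: "'a::monoid_mult \<Rightarrow> 'a \<Rightarrow> bool" where
  "drazin_inverse A D \<longleftrightarrow> D * A = A * D \<and> D ^ 2 * A = D \<and> (\<exists>p\<ge>1. A ^ (p + 1) * D = A ^ p)"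

definition drazin_invertible :: "'a::monoid_mult \<Rightarrow> bool" where
  "drazin_invertible A \<longleftrightarrow> (\<exists>D. drazin_inverse A D)"

lemma drazin_inverse_unique:
  fixes A :: "'a::monoid_mult"
  assumes "drazin_inverse A D" "drazin_inverse A E"
  shows "D = E"
proof -
  have comm: "D ^ i * A ^ j = A ^ j * D ^ i" if "drazin_inverse A D" for D i j and A :: 'a
  proof -
    have "A ^ j * D = D * A ^ j"
      using that by (intro power_commuting_commutes) (simp add: drazin_inverse_def)
    then show ?thesis using power_commuting_commutes[of D "A ^ j" i] by simp
  qed
  have key: "D ^ Suc k * A ^ k = D" if "drazin_inverse A D" for D k and A :: 'a
  proof (induction k)
    case (Suc k)
    have "D ^ Suc (Suc k) * A ^ Suc k = D ^ k * (D ^ 2 * A) * A ^ k"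
      by (simp only: power_Suc2[of D] power_Suc[of A] power2_eq_square mult.assoc)
    also have "\<dots> = D ^ Suc k * A ^ k"
      using that by (simp add: drazin_inverse_def power_commutes)
    finally show ?case using Suc by simp
  qed simp
  have stable: "A ^ (n + k) * D ^ k = A ^ n"
    if "A ^ (p + 1) * D = A ^ p" "p \<le> n" for p n k D and A :: 'a
  proof (induction k)
    case (Suc k)
    have e: "n + Suc k = (n - p + k) + (p + 1)" "n + k = (n - p + k) + p"
      using that(2) by simp_all
    have "A ^ (n + Suc k) * D ^ Suc k = A ^ (n - p + k) * (A ^ (p + 1) * D) * D ^ k"
      unfolding e by (simp only: power_add[of A "n - p + k"] power_Suc[of D] mult.assoc)
    also have "\<dots> = A ^ (n + k) * D ^ k"
      unfolding that(1) e by (simp only: power_add[of A "n - p + k"])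
    finally show ?case using Suc by simp
  qed simp
  obtain p q where p: "A ^ (p + 1) * D = A ^ p" and q: "A ^ (q + 1) * E = A ^ q"
    using assms by (auto simp: drazin_inverse_def)
  define n where "n = p + q"
  have pn: "A ^ (n + k) * D ^ k = A ^ n" and qn: "A ^ (n + k) * E ^ k = A ^ n" for k
    using stable[OF p] stable[OF q] by (simp_all add: n_def)
  have "D = D ^ Suc n * A ^ n" using key[OF assms(1)] by simp
  also have "\<dots> = D ^ Suc n * A ^ (n + Suc n) * E ^ Suc n"
    by (simp only: qn mult.assoc)
  also have "\<dots> = A ^ n * E ^ Suc n"
    by (simp only: comm[OF assms(1)] pn)
  also have "\<dots> = E" using key[OF assms(2)] comm[OF assms(2)] by metis
  finally show ?thesis .
qed

text \<open>Only meaningful for Drazin invertible elements, where the inverse is unique.\<close>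

definition drazin :: "'a::monoid_mult \<Rightarrow> 'a" where
  "drazin A = (THE D. drazin_inverse A D)"

lemma drazin_eqI: "drazin_inverse A D \<Longrightarrow> drazin A = D"
  unfolding drazin_def using drazin_inverse_unique by blast

lemma drazin_inverse_drazin: "drazin_invertible A \<Longrightarrow> drazin_inverse A (drazin A)"
  unfolding drazin_invertible_def using drazin_eqI by blast

definition commutator :: "'a::ring \<Rightarrow> 'a \<Rightarrow> 'a" where
  "commutator S T = S * T - T * S"

definition triangle_op :: "nat \<Rightarrow> 'a::complex_inner bop \<Rightarrow> 'a bop \<Rightarrow> 'a bop \<Rightarrow> 'a bop" where
  "triangle_op m S T Z =
     (\<Sum>j=0..m. ((- 1) ^ j * real (m choose j)) *\<^sub>R (S ^ (m - j) * Z * T ^ (m - j)))"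

definition left_invertible ::
    "'a::complex_inner bop \<Rightarrow> nat \<Rightarrow> 'a bop \<Rightarrow> 'a bop \<Rightarrow> bool" where
  "left_invertible Z m S T \<longleftrightarrow> triangle_op m S T Z = 0"

end

theory Submission
  imports Defs
begin

text \<open>The operator in the conclusion is applied to \<open>X * Y\<close>, and the hypotheses force \<open>X * Y = 0\<close>.

  In \<open>\<triangle>\<^sup>m(Z)\<close> for \<open>(S, T)\<close> every term but the last begins with a factor \<open>S\<close>, and the last term is
  \<open>\<plusminus>Z\<close>. If the sum vanishes, \<open>Z\<close> therefore lies in the right ideal generated by \<open>S\<close>, and every
  left identity of \<open>S\<close> is a left identity of \<open>Z\<close> (\<open>left_identity_of_left_invertible\<close>). For
  \<open>S = adj (drazin A)\<close> such a left identity is the adjoint of the Drazin idempotent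
  \<open>A * drazin A\<close>. So \<open>X\<close> and \<open>Y\<close> are fixed from the left by the adjoints \<open>E\<close> and \<open>F\<close> of the Drazin
  idempotents of \<open>A\<close> and \<open>B\<close>. Since \<open>B * A = A * B = 0\<close>, these idempotents annihilate each other,
  so \<open>E * F = 0\<close>, and the commutation of \<open>X\<close> and \<open>Y\<close> gives
  \<open>X * Y = E * (X * Y) = E * (Y * X) = E * F * (Y * X) = 0\<close>.\<close>

lemma adj_eqI:
  assumes "\<And>x y. cinner (bop_apply T x) y = cinner x (bop_apply S y)"
  shows "adj T = S"
  using adj_ex1[of T] assms cinner_adj by blast

lemma adj_mult: "adj (S * T) = adj T * adj S"
  by (rule adj_eqI) (simp add: times_bop.rep_eq cinner_adj)

lemma adj_zero: "adj 0 = 0"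
  by (rule adj_eqI) (simp add: zero_bop.rep_eq)

text \<open>Multiplying \<open>\<triangle>\<^sup>m(Z) = 0\<close> by \<open>E\<close> from the left changes only the summand \<open>\<plusminus>Z\<close>, the one in which
  \<open>S\<close> has exponent zero; hence that summand cannot change either.\<close>

lemma left_identity_of_left_invertible:
  assumes inv: "left_invertible Z m S T" and E: "E * S = S"
  shows "E * Z = Z"
proof -
  define R where
    "R = (\<Sum>j<m. ((- 1) ^ j * real (m choose j)) *\<^sub>R (S ^ (m - j) * Z * T ^ (m - j)))"
  have split: "R + (- 1) ^ m *\<^sub>R Z = 0"
    using inv by (simp add: left_invertible_def triangle_op_def R_def atLeast0AtMost
        flip: lessThan_Suc_atMost)
  have "E * S ^ (m - j) = S ^ (m - j)" if "j < m" for j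
    using that E by (cases "m - j") (simp_all add: mult.assoc[symmetric])
  then have "E * R = R"
    by (simp add: R_def sum_distrib_left mult.assoc[symmetric])
  with split have "(- 1) ^ m *\<^sub>R (E * Z) = (- 1 :: real) ^ m *\<^sub>R Z"
    by (metis add_left_imp_eq distrib_left mult_scaleR_right mult_zero_right)
  then show ?thesis by simp
qed

lemma adj_drazin_idempotent_left_identity:
  assumes "drazin_invertible A"
  shows "adj (A * drazin A) * adj (drazin A) = adj (drazin A)"
proof -
  have "drazin A * (A * drazin A) = drazin A"
    using drazin_inverse_drazin[OF assms]
    by (metis drazin_inverse_def mult.assoc power2_eq_square)
  then show ?thesis by (metis adj_mult)
qed

theorem theorem2p10:
  fixes A B X Y :: "'h::chilbert_space bop" and m n :: nat
  assumes inf_dim: "\<not> (\<exists>F::'h set. finite F \<and> cvec.span F = UNIV)"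
    and "m \<ge> 1" "n \<ge> 1"
    and "drazin_invertible A" "drazin_invertible B"
    and "left_invertible X m (adj (drazin A)) A"
    and "left_invertible Y n (adj (drazin B)) B"
    and "commutator X Y = 0" "commutator A B = 0"
    and "commutator (adj A) Y = 0" "commutator (adj B) X = 0"
    and "A * B = 0"
  shows "triangle_op (m + n - 1) (adj (drazin (A + B))) (A + B) (X * Y) = 0"
proof -
  define E where "E = adj (A * drazin A)"
  define F where "F = adj (B * drazin B)"
  have X: "E * X = X"
    unfolding E_def using assms adj_drazin_idempotent_left_identity
    by (blast intro: left_identity_of_left_invertible)
  have Y: "F * Y = Y"
    unfolding F_def using assms adj_drazin_idempotent_left_identity
    by (blast intro: left_identity_of_left_invertible)
  have comm: "X * Y = Y * X" and BA: "B * A = 0"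
    using assms by (simp_all add: commutator_def)
  have "B * drazin B = drazin B * B"
    using drazin_inverse_drazin[OF \<open>drazin_invertible B\<close>] by (simp add: drazin_inverse_def)
  then have "B * drazin B * (A * drazin A) = drazin B * (B * A) * drazin A"
    by (simp add: mult.assoc)
  then have EF: "E * F = 0"
    by (simp add: E_def F_def BA adj_zero flip: adj_mult)
  have "X * Y = E * (X * Y)"
    by (simp add: X mult.assoc[symmetric])
  also have "\<dots> = E * F * (Y * X)"
    by (simp add: comm Y mult.assoc) (simp add: Y mult.assoc[symmetric])
  also have "\<dots> = 0"
    by (simp add: EF)
  finally show ?thesis
    by (simp add: triangle_op_def)
qed

end
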